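(* Let $r(x)=1$ on $I=(0,1)$. The condition number of the mass matrix $M_r(\mathbf b)$ is bounded by $\mathcal O\left(n/h_{\min}^3\right)$; that is, there is an absolute constant $C>0$ such that for every integer $n\ge 1$ and all breakpoints $0=b_0<b_1<\cdots<b_n<b_{n+1}=1$, the spectral condition number of $M_r(\mathbf b)$ satisfies $$\kappa\left(M_r(\mathbf b)\right)\le C\,\frac{n}{h_{\min}^{3}} .$$
   Context: Let $\sigma(t)=\max\{0,t\}$ be the ReLU function. For breakpoints $0=b_0<b_1<\cdots<b_n<b_{n+1}=1$ write $\mathbf b=(b_1,\dots,b_n)^T$, $h_i=b_{i+1}-b_i$ for $i=0,\dots,n$, and $h_{\min}=\min_{0\le i\le n}h_i$. The mass matrix associated with a weight function $r$ is the $(n+1)\times(n+1)$ symmetric matrix $M_r(\mathbf b)=(m_{ij})$ with $m_{ij}=\int_0^1 r(x)\,\sigma(x-b_{i-1})\,\sigma(x-b_{j-1})\,dx$, $i,j=1,\dots,n+1$. The condition number is the ratio of the largest to the smallest eigenvalue (2-norm condition number) of this symmetric positive definite matrix. *)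

theory Defs
  imports
    "HOL-Analysis.Analysis"
    "Jordan_Normal_Form.Spectral_Radius"
begin

definition relu :: "real \<Rightarrow> real" where
  "relu t = max 0 t"

text \<open>Only the values \<open>b 0, \<dots>, b (n + 1)\<close> matter; the boundary points \<open>0\<close> and \<open>1\<close> are included.\<close>

definition breakpoints :: "nat \<Rightarrow> (nat \<Rightarrow> real) \<Rightarrow> bool" where
  "breakpoints n b \<longleftrightarrow> b 0 = 0 \<and> b (n + 1) = 1 \<and> (\<forall>i\<le>n. b i < b (i + 1))"

definition mesh_size :: "(nat \<Rightarrow> real) \<Rightarrow> nat \<Rightarrow> real" where
  "mesh_size b i = b (i + 1) - b i"

definition h_min :: "nat \<Rightarrow> (nat \<Rightarrow> real) \<Rightarrow> real" where
  "h_min n b = Min (mesh_size b ` {0..n})"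

text \<open>Matrix indices start at \<open>0\<close>: the entry at position \<open>(i, j)\<close> here is the entry
  \<open>m\<close> with indices \<open>i + 1\<close>, \<open>j + 1\<close> in one-based numbering, whence \<open>b i\<close> and \<open>b j\<close>.\<close>

definition mass_matrix :: "(real \<Rightarrow> real) \<Rightarrow> nat \<Rightarrow> (nat \<Rightarrow> real) \<Rightarrow> real Matrix.mat" where
  "mass_matrix r n b = Matrix.mat (n + 1) (n + 1)
     (\<lambda>(i, j). integral {0..1} (\<lambda>x. r x * relu (x - b i) * relu (x - b j)))"

text \<open>For symmetric positive definite matrices only: there the set of real eigenvalues is
  finite, nonempty and positive, so that \<open>Max\<close>, \<open>Min\<close> and the quotient are meaningful.\<close>

definition spectral_condition_number :: "real Matrix.mat \<Rightarrow> real" where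
  "spectral_condition_number A = Max (spectrum A) / Min (spectrum A)"

end

theory Submission
  imports Defs
begin

text \<open>For \<open>v\<close> put \<open>f x = (\<Sum>i. v i * relu (x - b i))\<close>; the quadratic form of the mass matrix is the
  integral of \<open>f\<^sup>2\<close>. Cauchy-Schwarz gives the upper bound \<open>n + 1\<close> for the eigenvalues. On the \<open>k\<close>-th
  mesh interval \<open>f\<close> is affine with slope \<open>s k = (\<Sum>i\<le>k. v i)\<close>, so with \<open>h = h_min n b\<close> the integral of \<open>f\<^sup>2\<close> there is at least
  \<open>(s k)\<^sup>2 * h\<^sup>3 / 12\<close>; as \<open>v k = s k - s (k - 1)\<close>, the sum of the \<open>(s k)\<^sup>2\<close> is at least a quarter
  of the sum of the \<open>(v k)\<^sup>2\<close>, and every eigenvalue is at least \<open>h\<^sup>3 / 48\<close>.\<close>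

unbundle no vec_syntax

section \<open>Affine pieces, partial sums and splitting of integrals\<close>

text \<open>The integral is exactly \<open>b - a\<close> times the squared value at the midpoint,
  plus the left-hand side; the first summand is nonnegative and is dropped.\<close>

lemma integral_affine_square_ge:
  fixes a b c s :: real
  assumes "a \<le> b"
  shows "s\<^sup>2 * (b - a) ^ 3 / 12 \<le> integral {a..b} (\<lambda>x. (c + s * x)\<^sup>2)"
proof -
  let ?F = "\<lambda>x. c\<^sup>2 * x + c * s * x\<^sup>2 + s\<^sup>2 * x ^ 3 / 3"
  have "((\<lambda>x. (c + s * x)\<^sup>2) has_integral (?F b - ?F a)) {a..b}"
    by (rule fundamental_theorem_of_calculus[OF assms])
      (auto intro!: derivative_eq_intros
        simp: has_real_derivative_iff_has_vector_derivative[symmetric] power2_eq_square algebra_simps)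
  then have "integral {a..b} (\<lambda>x. (c + s * x)\<^sup>2) = ?F b - ?F a"
    by (rule integral_unique)
  also have "\<dots> = (b - a) * (c + s * ((a + b) / 2))\<^sup>2 + s\<^sup>2 * (b - a) ^ 3 / 12"
    by (simp add: field_simps power2_eq_square power3_eq_cube)
  finally show ?thesis
    using assms by simp
qed

text \<open>The extra square of the full sum strengthens the induction hypothesis: it pays for the
  previous partial sum when \<open>v N\<close> is written as a difference of two partial
  sums.\<close>

lemma sum_squares_le_partial_sums:
  fixes v :: "nat \<Rightarrow> real"
  shows "(\<Sum>i<N. (v i)\<^sup>2) + 2 * (\<Sum>i<N. v i)\<^sup>2 \<le> 4 * (\<Sum>k<N. (\<Sum>i<Suc k. v i)\<^sup>2)"
proof (induction N)
  case (Suc N)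
  let ?s = "\<Sum>i<N. v i"
  \<comment> \<open>Right side minus left side is the square of \<open>2 * ?s + v N\<close>.\<close>
  have "(v N)\<^sup>2 \<le> 2 * (?s + v N)\<^sup>2 + 2 * ?s\<^sup>2"
    using zero_le_power2[of "2 * ?s + v N"] by (simp add: power2_eq_square algebra_simps)
  with Suc show ?case
    by simp
qed simp

text \<open>The ordering \<open>b 0 \<le> b N\<close> is carried through the induction because
  joining two adjacent integrals requires it.\<close>

lemma integral_combine_sum:
  fixes f :: "real \<Rightarrow> real" and b :: "nat \<Rightarrow> real"
  assumes "\<And>i. i < N \<Longrightarrow> b i \<le> b (Suc i)" and "continuous_on UNIV f"
  shows "b 0 \<le> b N \<and> integral {b 0..b N} f = (\<Sum>k<N. integral {b k..b (Suc k)} f)"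
  using assms(1)
proof (induction N)
  case (Suc N)
  then have IH: "b 0 \<le> b N" "integral {b 0..b N} f = (\<Sum>k<N. integral {b k..b (Suc k)} f)"
    and le: "b N \<le> b (Suc N)"
    by auto
  have "f integrable_on {b 0..b (Suc N)}"
    using assms(2) by (intro integrable_continuous_interval) (rule continuous_on_subset, auto)
  from Henstock_Kurzweil_Integration.integral_combine[OF IH(1) le this] IH le show ?case
    by simp
qed simp

lemma continuous_relu_combination:
  "continuous_on S (\<lambda>x. \<Sum>i<N. v i * relu (x - b i))"
  unfolding relu_def by (intro continuous_intros)

lemma breakpoints_mono:
  assumes "breakpoints n b" "i \<le> j" "j \<le> n + 1"
  shows "b i \<le> b j"
  using assms(2,3)
proof (induction j rule: dec_induct)
  case (step m)
  then have "b m < b (m + 1)"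
    using assms(1) by (simp add: breakpoints_def)
  with step show ?case
    by simp
qed simp

lemma h_min_le:
  assumes "k \<le> n"
  shows "h_min n b \<le> b (Suc k) - b k"
  using assms by (auto simp: h_min_def mesh_size_def intro!: Min_le)

lemma h_min_pos:
  assumes "breakpoints n b"
  shows "h_min n b > 0"
  using assms by (auto simp: h_min_def mesh_size_def breakpoints_def)

section \<open>Two-sided bounds for the quadratic form\<close>

lemma integral_relu_combination_ge:
  fixes v :: "nat \<Rightarrow> real"
  assumes b: "breakpoints n b"
  shows "h_min n b ^ 3 / 48 * (\<Sum>i<n+1. (v i)\<^sup>2)
    \<le> integral {0..1} (\<lambda>x. (\<Sum>i<n+1. v i * relu (x - b i))\<^sup>2)"
proof -
  let ?f = "\<lambda>x. \<Sum>i<n+1. v i * relu (x - b i)"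
  let ?s = "\<lambda>k. \<Sum>i<Suc k. v i"
  let ?h = "h_min n b"
  have piece: "(?s k)\<^sup>2 * ?h ^ 3 / 12 \<le> integral {b k..b (Suc k)} (\<lambda>x. (?f x)\<^sup>2)" if k: "k \<le> n" for k
  proof -
    have le: "b k \<le> b (Suc k)"
      using breakpoints_mono[OF b] k by simp
    \<comment> \<open>On this interval the terms with \<open>i > k\<close> vanish, since
      \<open>x \<le> b (Suc k) \<le> b i\<close>, and in those with \<open>i \<le> k\<close> relu
      acts as the identity, since \<open>b i \<le> b k \<le> x\<close>.\<close>
    have affine: "?f x = - (\<Sum>i<Suc k. v i * b i) + ?s k * x" if x: "x \<in> {b k..b (Suc k)}" for x
    proof -
      have "?f x = (\<Sum>i<Suc k. v i * relu (x - b i))"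
      proof (rule sum.mono_neutral_right)
        show "\<forall>i\<in>{..<n + 1} - {..<Suc k}. v i * relu (x - b i) = 0"
        proof
          fix i assume "i \<in> {..<n + 1} - {..<Suc k}"
          then have "b (Suc k) \<le> b i"
            by (intro breakpoints_mono[OF b]) auto
          with x show "v i * relu (x - b i) = 0"
            by (simp add: relu_def)
        qed
      qed (use k in auto)
      also have "\<dots> = (\<Sum>i<Suc k. v i * (x - b i))"
      proof (rule sum.cong)
        fix i assume "i \<in> {..<Suc k}"
        then have "b i \<le> b k"
          using k by (intro breakpoints_mono[OF b]) auto
        with x show "v i * relu (x - b i) = v i * (x - b i)"
          by (simp add: relu_def)
      qed simp
      also have "\<dots> = - (\<Sum>i<Suc k. v i * b i) + ?s k * x"
        by (simp only: right_diff_distrib sum_subtractf sum_distrib_right)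
      finally show ?thesis .
    qed
    have "?h ^ 3 \<le> (b (Suc k) - b k) ^ 3"
      using h_min_le[OF k] h_min_pos[OF b] by (intro power_mono) auto
    then have "(?s k)\<^sup>2 * ?h ^ 3 / 12 \<le> (?s k)\<^sup>2 * (b (Suc k) - b k) ^ 3 / 12"
      by (intro divide_right_mono mult_left_mono) auto
    also have "\<dots> \<le> integral {b k..b (Suc k)} (\<lambda>x. (- (\<Sum>i<Suc k. v i * b i) + ?s k * x)\<^sup>2)"
      by (rule integral_affine_square_ge[OF le])
    also have "\<dots> = integral {b k..b (Suc k)} (\<lambda>x. (?f x)\<^sup>2)"
      by (intro Henstock_Kurzweil_Integration.integral_cong arg_cong[where f = "\<lambda>y. y\<^sup>2"])
        (rule affine[symmetric])
    finally show ?thesis .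
  qed
  \<comment> \<open>The constant 48 is 12 from the affine pieces times 4 from the partial
    sums.\<close>
  have "?h ^ 3 / 48 * (\<Sum>i<n+1. (v i)\<^sup>2) \<le> ?h ^ 3 / 48 * (4 * (\<Sum>k<n+1. (?s k)\<^sup>2))"
    using sum_squares_le_partial_sums[of v "n + 1"] zero_le_power2[of "\<Sum>i<n+1. v i"] h_min_pos[OF b]
    by (intro mult_left_mono) (linarith, simp)
  also have "\<dots> = (\<Sum>k<n+1. (?s k)\<^sup>2 * ?h ^ 3 / 12)"
    by (simp only: sum_distrib_left) (rule sum.cong, simp_all)
  also have "\<dots> \<le> (\<Sum>k<n+1. integral {b k..b (Suc k)} (\<lambda>x. (?f x)\<^sup>2))"
    by (intro sum_mono piece) simp
  also have "\<dots> = integral {b 0..b (n + 1)} (\<lambda>x. (?f x)\<^sup>2)"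
    using breakpoints_mono[OF b]
    by (intro conjunct2[OF integral_combine_sum, symmetric] continuous_intros
        continuous_relu_combination) auto
  finally show ?thesis
    using b by (simp only: breakpoints_def)
qed

text \<open>The bound already holds pointwise on the unit interval: there each
  \<open>relu (x - b i)\<close> lies between 0 and 1, so Cauchy-Schwarz applies with a second factor
  of at most \<open>n + 1\<close>.\<close>

lemma integral_relu_combination_le:
  fixes v :: "nat \<Rightarrow> real"
  assumes b: "breakpoints n b"
  shows "integral {0..1} (\<lambda>x. (\<Sum>i<n+1. v i * relu (x - b i))\<^sup>2) \<le> (real n + 1) * (\<Sum>i<n+1. (v i)\<^sup>2)"
proof -
  let ?f = "\<lambda>x. \<Sum>i<n+1. v i * relu (x - b i)"
  have "(?f x)\<^sup>2 \<le> (real n + 1) * (\<Sum>i<n+1. (v i)\<^sup>2)" if x: "x \<in> {0..1}" for x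
  proof -
    have "(relu (x - b i))\<^sup>2 \<le> 1" if "i < n + 1" for i
    proof -
      have "0 \<le> b i"
        using breakpoints_mono[OF b, of 0 i] b that by (simp add: breakpoints_def)
      with x have "0 \<le> relu (x - b i)" "relu (x - b i) \<le> 1"
        by (auto simp: relu_def)
      then show ?thesis
        by (simp add: power_le_one)
    qed
    then have "(\<Sum>i<n+1. (relu (x - b i))\<^sup>2) \<le> (\<Sum>i<n+1. 1)"
      by (intro sum_mono) simp
    then have "(\<Sum>i<n+1. (v i)\<^sup>2) * (\<Sum>i<n+1. (relu (x - b i))\<^sup>2) \<le> (\<Sum>i<n+1. (v i)\<^sup>2) * (real n + 1)"
      by (intro mult_left_mono sum_nonneg) auto
    with Cauchy_Schwarz_ineq_sum[of v "\<lambda>i. relu (x - b i)" "{..<n+1}"] show ?thesis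
      by (simp add: mult.commute)
  qed
  then have "integral {0..1} (\<lambda>x. (?f x)\<^sup>2) \<le> integral {0..1} (\<lambda>x::real. (real n + 1) * (\<Sum>i<n+1. (v i)\<^sup>2))"
    by (intro integral_le integrable_continuous_interval continuous_intros continuous_relu_combination)
  then show ?thesis
    by simp
qed

section \<open>From the quadratic form to eigenvalues\<close>

text \<open>The mass matrix is the Gram matrix of the functions \<open>relu (x - b i)\<close> in
  L2(0,1).\<close>

lemma mass_matrix_quadratic_form:
  fixes v :: "nat \<Rightarrow> real"
  shows "(\<Sum>i<n+1. \<Sum>j<n+1. v i * v j * mass_matrix (\<lambda>x. 1) n b $$ (i, j))
    = integral {0..1} (\<lambda>x. (\<Sum>i<n+1. v i * relu (x - b i))\<^sup>2)"
proof -
  let ?g = "\<lambda>i j x. v i * v j * (relu (x - b i) * relu (x - b j))"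
  have int: "?g i j integrable_on {0..1}" for i j
    unfolding relu_def by (intro integrable_continuous_interval continuous_intros)
  have "integral {0..1} (\<lambda>x. (\<Sum>i<n+1. v i * relu (x - b i))\<^sup>2)
    = integral {0..1} (\<lambda>x. \<Sum>i<n+1. \<Sum>j<n+1. ?g i j x)"
    by (simp only: power2_eq_square sum_product mult_ac)
  also have "\<dots> = (\<Sum>i<n+1. \<Sum>j<n+1. integral {0..1} (?g i j))"
    by (simp only: Henstock_Kurzweil_Integration.integral_sum int integrable_sum finite_lessThan)
  also have "\<dots> = (\<Sum>i<n+1. \<Sum>j<n+1. v i * v j * mass_matrix (\<lambda>x. 1) n b $$ (i, j))"
    by (intro sum.cong) (auto simp: mass_matrix_def)
  finally show ?thesis ..
qed

text \<open>Pairing the eigenvector equation with \<open>v\<close> turns bounds on the quadratic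
  form into bounds on \<open>l\<close>.\<close>

lemma eigenvector_quadratic_form:
  fixes A :: "real Matrix.mat"
  assumes "A \<in> carrier_mat m m" "eigenvector A v l"
  shows "(\<Sum>i<m. \<Sum>j<m. (v $ i) * (v $ j) * A $$ (i, j)) = l * (\<Sum>i<m. (v $ i)\<^sup>2)"
proof -
  have v: "v \<in> carrier_vec m" and ev: "A *\<^sub>v v = l \<cdot>\<^sub>v v"
    using assms by (auto simp: eigenvector_def)
  have "(\<Sum>j<m. A $$ (i, j) * v $ j) = l * v $ i" if "i < m" for i
    using arg_cong[OF ev, of "\<lambda>w. w $ i"] that v assms(1)
    by (simp add: scalar_prod_def atLeast0LessThan)
  then have "(\<Sum>i<m. v $ i * (\<Sum>j<m. A $$ (i, j) * v $ j)) = (\<Sum>i<m. v $ i * (l * v $ i))"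
    by (intro sum.cong) auto
  then show ?thesis
    by (simp add: sum_distrib_left power2_eq_square mult_ac)
qed

section \<open>Existence of a real eigenvalue\<close>

text \<open>The Hermitian form \<open>q\<close> of an eigenvector equals \<open>l\<close> times its
  squared norm \<open>r > 0\<close>, and symmetry of \<open>A\<close> makes \<open>q\<close>
  real.\<close>

lemma symmetric_complex_eigenvalue_real:
  fixes A :: "real Matrix.mat"
  assumes A: "A \<in> carrier_mat m m" and sym: "\<And>i j. i < m \<Longrightarrow> j < m \<Longrightarrow> A $$ (i, j) = A $$ (j, i)"
    and ev: "eigenvalue (map_mat complex_of_real A) l"
  shows "l \<in> \<real>"
proof -
  obtain v where v: "v \<in> carrier_vec m" "v \<noteq> 0\<^sub>v m" and eq: "map_mat complex_of_real A *\<^sub>v v = l \<cdot>\<^sub>v v"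
    using ev A by (auto simp: eigenvalue_def eigenvector_def)
  have row: "(\<Sum>j<m. complex_of_real (A $$ (i, j)) * v $ j) = l * v $ i" if "i < m" for i
    using arg_cong[OF eq, of "\<lambda>w. w $ i"] that v A
    by (simp add: scalar_prod_def atLeast0LessThan)
  define q where "q = (\<Sum>i<m. \<Sum>j<m. cnj (v $ i) * v $ j * complex_of_real (A $$ (i, j)))"
  define r where "r = (\<Sum>i<m. (cmod (v $ i))\<^sup>2)"
  have "(\<Sum>i<m. cnj (v $ i) * (\<Sum>j<m. complex_of_real (A $$ (i, j)) * v $ j))
    = (\<Sum>i<m. cnj (v $ i) * (l * v $ i))"
    by (intro sum.cong) (auto simp: row)
  then have q: "q = l * complex_of_real r"
    unfolding q_def r_def
    by (simp add: sum_distrib_left complex_norm_square mult_ac del: of_real_power)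
  \<comment> \<open>Conjugation exchanges the roles of \<open>i\<close> and \<open>j\<close>;
    swapping the sums and using symmetry gives back \<open>q\<close>.\<close>
  have "cnj q = (\<Sum>i<m. \<Sum>j<m. cnj (v $ j) * v $ i * complex_of_real (A $$ (i, j)))"
    by (simp add: q_def mult_ac)
  also have "\<dots> = (\<Sum>j<m. \<Sum>i<m. cnj (v $ j) * v $ i * complex_of_real (A $$ (i, j)))"
    by (rule sum.swap)
  also have "\<dots> = q"
    unfolding q_def by (intro sum.cong) (auto simp: sym)
  finally have "q \<in> \<real>"
    by (simp add: Reals_cnj_iff)
  obtain i where "i < m" "v $ i \<noteq> 0"
    using v by (metis carrier_vecD eq_vecI index_zero_vec)
  then have "r > 0"
    unfolding r_def by (intro sum_pos2[of _ i]) auto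
  then have "l = q / complex_of_real r"
    using q by simp
  with \<open>q \<in> \<real>\<close> show ?thesis
    by simp
qed

text \<open>This makes \<open>Max\<close> and \<open>Min\<close> of the real spectrum meaningful.
  Over the complex numbers an eigenvalue exists; it is real, hence a root of the real characteristic
  polynomial.\<close>

lemma symmetric_spectrum_nonempty:
  fixes A :: "real Matrix.mat"
  assumes A: "A \<in> carrier_mat m m" and "m > 0"
    and sym: "\<And>i j. i < m \<Longrightarrow> j < m \<Longrightarrow> A $$ (i, j) = A $$ (j, i)"
  shows "spectrum A \<noteq> {}"
proof -
  have A': "map_mat complex_of_real A \<in> carrier_mat m m"
    using A by simp
  from spectrum_non_empty[OF this] \<open>m > 0\<close>
  obtain l where l: "eigenvalue (map_mat complex_of_real A) l"
    by (auto simp: spectrum_def)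
  then obtain x where x: "l = complex_of_real x"
    using symmetric_complex_eigenvalue_real[OF A sym] by (auto elim: Reals_cases)
  from l have "poly (char_poly (map_mat complex_of_real A)) (complex_of_real x) = 0"
    by (simp add: eigenvalue_root_char_poly[OF A'] x)
  then have "poly (char_poly A) x = 0"
    by (simp add: of_real_hom.char_poly_hom[OF A])
  then show ?thesis
    using eigenvalue_root_char_poly[OF A] by (auto simp: spectrum_def)
qed

section \<open>Eigenvalue bounds and the condition number\<close>

lemma mass_matrix_eigenvalue_bounds:
  assumes b: "breakpoints n b" and l: "l \<in> spectrum (mass_matrix (\<lambda>x. 1) n b)"
  shows "h_min n b ^ 3 / 48 \<le> l" "l \<le> real n + 1"
proof -
  have A: "mass_matrix (\<lambda>x. 1) n b \<in> carrier_mat (n + 1) (n + 1)"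
    by (simp add: mass_matrix_def)
  obtain v where v: "eigenvector (mass_matrix (\<lambda>x. 1) n b) v l"
    using l by (auto simp: spectrum_def eigenvalue_def)
  then have "v \<in> carrier_vec (n + 1)" "v \<noteq> 0\<^sub>v (n + 1)"
    using A by (auto simp: eigenvector_def)
  then obtain i where "i < n + 1" "v $ i \<noteq> 0"
    by (metis carrier_vecD eq_vecI index_zero_vec)
  then have pos: "(\<Sum>i<n+1. (v $ i)\<^sup>2) > 0"
    by (intro sum_pos2[of _ i]) auto
  have form: "integral {0..1} (\<lambda>x. (\<Sum>i<n+1. v $ i * relu (x - b i))\<^sup>2) = l * (\<Sum>i<n+1. (v $ i)\<^sup>2)"
    using mass_matrix_quadratic_form[of "\<lambda>i. v $ i" n b] eigenvector_quadratic_form[OF A v] by simp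
  show "h_min n b ^ 3 / 48 \<le> l"
    using integral_relu_combination_ge[OF b, of "\<lambda>i. v $ i"] pos
    by (simp only: form mult_le_cancel_right_pos)
  show "l \<le> real n + 1"
    using integral_relu_combination_le[OF b, of "\<lambda>i. v $ i"] pos
    by (simp only: form mult_le_cancel_right_pos)
qed

lemma mass_matrix_condition_number_le:
  assumes b: "breakpoints n b"
  shows "spectral_condition_number (mass_matrix (\<lambda>x. 1) n b) \<le> 48 * (real n + 1) / h_min n b ^ 3"
proof -
  let ?A = "mass_matrix (\<lambda>x. 1) n b"
  have A: "?A \<in> carrier_mat (n + 1) (n + 1)"
    by (simp add: mass_matrix_def)
  have "?A $$ (i, j) = ?A $$ (j, i)" if "i < n + 1" "j < n + 1" for i j
    using that by (simp add: mass_matrix_def mult.commute)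
  then have ne: "spectrum ?A \<noteq> {}"
    by (intro symmetric_spectrum_nonempty[OF A]) auto
  have fin: "finite (spectrum ?A)"
    using card_finite_spectrum(1)[OF A] .
  have h: "h_min n b ^ 3 / 48 > 0"
    using h_min_pos[OF b] by simp
  have "Max (spectrum ?A) \<le> real n + 1" "h_min n b ^ 3 / 48 \<le> Min (spectrum ?A)"
    using mass_matrix_eigenvalue_bounds[OF b] ne fin by auto
  then have "spectral_condition_number ?A \<le> (real n + 1) / (h_min n b ^ 3 / 48)"
    unfolding spectral_condition_number_def using h by (intro frac_le) auto
  then show ?thesis
    by (simp add: mult.commute)
qed

theorem lemma4p2:
  shows "\<exists>C::real. C > 0 \<and>
    (\<forall>(n::nat) (b::nat \<Rightarrow> real). n \<ge> 1 \<longrightarrow> breakpoints n b \<longrightarrow>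
       spectral_condition_number (mass_matrix (\<lambda>x. 1) n b) \<le> C * (real n / h_min n b ^ 3))"
proof (intro exI[of _ 96] conjI allI impI)
  fix n :: nat and b :: "nat \<Rightarrow> real"
  assume n: "n \<ge> 1" and b: "breakpoints n b"
  \<comment> \<open>Since \<open>n \<ge> 1\<close>, \<open>n + 1 \<le> 2 * n\<close>, which doubles
    48 to the witness 96.\<close>
  have "48 * (real n + 1) / h_min n b ^ 3 \<le> 96 * real n / h_min n b ^ 3"
    using n h_min_pos[OF b] by (intro divide_right_mono) auto
  with mass_matrix_condition_number_le[OF b]
  show "spectral_condition_number (mass_matrix (\<lambda>x. 1) n b) \<le> 96 * (real n / h_min n b ^ 3)"
    by simp
qed simp

end
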